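(* Fix an integer $k\geq 2$ and a nonempty (finite or infinite) sequence of permutation patterns $\tau^{(1)},\tau^{(2)},\ldots$, where each $\tau^{(i)}\in S_{m_i}$ for some $m_i\ge 1$. If the permutations $\tau^{(1)},\tau^{(2)},\ldots$ are all sum indecomposable, then the two limits below exist and $$\lim_{n\to\infty}|\mathrm{Av}_n(\tau^{(1)},\tau^{(2)},\ldots)|^{1/n}=\lim_{n\to\infty}|\mathcal H_n^k(\tau^{(1)},\tau^{(2)},\ldots)|^{1/n}.$$
   Context: $S_n$ is the set of permutations of $[n]=\{1,\ldots,n\}$, written as words in one-line notation. A permutation $\sigma=\sigma_1\cdots\sigma_n$ contains the pattern $\tau=\tau_1\cdots\tau_m\in S_m$ if there are indices $i_1<\cdots<i_m$ in $[n]$ such that for all $j,l\in[m]$ one has $\sigma_{i_j}<\sigma_{i_l}$ if and only if $\tau_j<\tau_l$; otherwise $\sigma$ avoids $\tau$. $\mathrm{Av}_n(\tau^{(1)},\tau^{(2)},\ldots)$ is the set of permutations in $S_n$ that avoid all of the patterns $\tau^{(1)},\tau^{(2)},\ldots$. For $\lambda\in S_\ell$ and $\mu\in S_m$ (with $\ell,m\ge 1$), the direct sum $\lambda\oplus\mu\in S_{\ell+m}$ is given by $(\lambda\oplus\mu)_i=\lambda_i$ for $1\le i\le \ell$ and $(\lambda\oplus\mu)_i=\mu_{i-\ell}+\ell$ for $\ell+1\le i\le \ell+m$. A permutation is sum indecomposable if it cannot be written as the direct sum of two shorter permutations. A complete $k$-ary tree is a rooted tree in which every vertex not in the penultimate or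 last level has exactly $k$ children and all vertices in the last level are as far left as possible. Equivalently, if $v_1,\ldots,v_n$ are the vertices in breadth-first order (starting from the root, level by level, each level from left to right), then the children of $v_i$ are those $v_j$ with $k(i-1)+2\le j\le ki+1$ and $j\le n$. For each $n$ there is exactly one complete $k$-ary tree with $n$ vertices. An $n$-vertex $k$-ary heap is a bijective labeling of the vertices of this tree by $[n]$ such that each vertex has a label smaller than the labels of its children. The permutation associated to a $k$-ary heap is the permutation in $S_n$ obtained by reading the labels of $v_1,v_2,\ldots,v_n$ in this order. $\mathcal H_n^k(\tau^{(1)},\tau^{(2)},\ldots)$ is the set of $n$-vertex $k$-ary heaps whose associated permutations avoid all of the patterns $\tau^{(1)},\tau^{(2)},\ldots$. *)

theory Defs
  imports Complex_Main "HOL-Library.FuncSet" "HOL-Combinatorics.Multiset_Permutations"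
begin

text \<open>
  Permutations are words in one-line notation over the letters \<open>1, \<dots>, n\<close>. The letters are
  1-based, but list positions are 0-based, so \<open>\<sigma>\<^sub>i\<close> is \<open>\<sigma> ! (i - 1)\<close>.
\<close>

definition perms :: "nat \<Rightarrow> nat list set" where
  "perms n = permutations_of_set {1..n}"

definition contains_pattern :: "nat list \<Rightarrow> nat list \<Rightarrow> bool" where
  "contains_pattern \<sigma> \<tau> \<longleftrightarrow>
    (\<exists>i. strict_mono_on {..<length \<tau>} i \<and> i ` {..<length \<tau>} \<subseteq> {..<length \<sigma>} \<and>
      (\<forall>j<length \<tau>. \<forall>l<length \<tau>. \<sigma> ! (i j) < \<sigma> ! (i l) \<longleftrightarrow> \<tau> ! j < \<tau> ! l))"

definition avoids_all :: "nat list \<Rightarrow> nat list set \<Rightarrow> bool" where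
  "avoids_all \<sigma> T \<longleftrightarrow> (\<forall>\<tau>\<in>T. \<not> contains_pattern \<sigma> \<tau>)"

definition Av :: "nat \<Rightarrow> nat list set \<Rightarrow> nat list set" where
  "Av n T = {\<sigma> \<in> perms n. avoids_all \<sigma> T}"

definition direct_sum :: "nat list \<Rightarrow> nat list \<Rightarrow> nat list" where
  "direct_sum \<rho> \<mu> = \<rho> @ map (\<lambda>x. x + length \<rho>) \<mu>"

definition sum_indecomposable :: "nat list \<Rightarrow> bool" where
  "sum_indecomposable \<sigma> \<longleftrightarrow>
    \<not> (\<exists>l\<ge>1. \<exists>m\<ge>1. \<exists>\<rho>\<in>perms l. \<exists>\<mu>\<in>perms m. \<sigma> = direct_sum \<rho> \<mu>)"

text \<open>
  The vertices \<open>v\<^sub>1, \<dots>, v\<^sub>n\<close> of the complete \<open>k\<close>-ary tree are represented by their breadth-first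
  indices \<open>1, \<dots>, n\<close>.
\<close>

definition tree_children :: "nat \<Rightarrow> nat \<Rightarrow> nat \<Rightarrow> nat set" where
  "tree_children k n i = {j. k * (i - 1) + 2 \<le> j \<and> j \<le> k * i + 1 \<and> j \<le> n}"

text \<open>Labelings are extensional functions, so that each heap is counted exactly once.\<close>

definition kary_heaps :: "nat \<Rightarrow> nat \<Rightarrow> (nat \<Rightarrow> nat) set" where
  "kary_heaps k n =
    {h \<in> {1..n} \<rightarrow>\<^sub>E {1..n}. bij_betw h {1..n} {1..n} \<and>
      (\<forall>i\<in>{1..n}. \<forall>j\<in>tree_children k n i. h i < h j)}"

definition heap_perm :: "nat \<Rightarrow> (nat \<Rightarrow> nat) \<Rightarrow> nat list" where
  "heap_perm n h = map h [1..<n + 1]"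

definition avoiding_heaps :: "nat \<Rightarrow> nat \<Rightarrow> nat list set \<Rightarrow> (nat \<Rightarrow> nat) set" where
  "avoiding_heaps k n T = {h \<in> kary_heaps k n. avoids_all (heap_perm n h) T}"

end

theory Submission
  imports Defs
begin

text \<open>
  Let \<open>a n\<close> count the avoiding permutations and \<open>h n \<le> a n\<close> the avoiding heaps. Since the patterns
  are sum indecomposable, avoidance is preserved by direct sums; and if \<open>q \<le> p\<close>, appending any
  avoiding permutation of length \<open>q\<close> on top of a heap with \<open>p\<close> vertices gives a heap, because all
  parents of the new vertices are old. Hence \<open>h (p + q) \<ge> h p * a q\<close> for \<open>q \<le> p\<close>, so \<open>h n\<close> is at
  least \<open>a m ^ (n div m - 1)\<close> for every \<open>m\<close>, and both growth rates equal the supremum of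
  \<open>a m powr (1 / m)\<close>. That this supremum is finite is the Stanley--Wilf conjecture, proved as by
  Marcus and Tardos: a matrix is contracted in square cells, few nonempty cells meet many rows
  or many columns, and iterating the contraction bounds first the size and then the number of
  the pattern-avoiding 0-1 matrices.
\<close>

subsection \<open>Pattern-avoiding 0-1 matrices\<close>

text \<open>A matrix is the set of the positions of its ones. The pattern consists of the points
  \<open>(u j, v j)\<close>; only strict inequalities have to be respected, so ties are unconstrained.\<close>

definition embeds :: "'i set \<Rightarrow> ('i \<Rightarrow> nat) \<Rightarrow> ('i \<Rightarrow> nat) \<Rightarrow> (nat \<times> nat) set \<Rightarrow> bool" where
  "embeds J u v A \<longleftrightarrow> (\<exists>f g. (\<forall>j\<in>J. (f j, g j) \<in> A) \<and>
    (\<forall>j\<in>J. \<forall>l\<in>J. (u j < u l \<longrightarrow> f j < f l) \<and> (v j < v l \<longrightarrow> g j < g l)))"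

lemma embeds_converse: "embeds J v u (A\<inverse>) \<longleftrightarrow> embeds J u v A"
  unfolding embeds_def by (simp only: converse_iff) blast

text \<open>Send \<open>j\<close> to the element of \<open>X\<close> whose rank is the number of
  points of \<open>J\<close> with smaller \<open>u\<close>. This rank is below
  \<open>card J\<close>, and ties in \<open>u\<close> receive the same value.\<close>

lemma ex_monotone_map:
  fixes u :: "'i \<Rightarrow> nat" and X :: "nat set"
  assumes "finite J" "finite X" "card J \<le> card X"
  shows "\<exists>f. (\<forall>j\<in>J. f j \<in> X) \<and> (\<forall>j\<in>J. \<forall>l\<in>J. u j < u l \<longrightarrow> f j < f l)"
proof -
  define r where "r j = card {i \<in> J. u i < u j}" for j
  have r: "r j < card X" if "j \<in> J" for j
  proof -
    have "r j < card J"
      unfolding r_def using assms(1) that by (intro psubset_card_mono) auto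
    then show ?thesis using assms(3) by simp
  qed
  have r_mono: "r j < r l" if "j \<in> J" "l \<in> J" "u j < u l" for j l
    unfolding r_def using assms(1) that by (intro psubset_card_mono) auto
  let ?f = "\<lambda>j. sorted_list_of_set X ! r j"
  have "?f j \<in> X" if "j \<in> J" for j
    using nth_mem[of "r j" "sorted_list_of_set X"] r[OF that] assms(2) by simp
  moreover have "?f j < ?f l" if "j \<in> J" "l \<in> J" "u j < u l" for j l
    using sorted_wrt_nth_less[OF strict_sorted_list_of_set r_mono[OF that], of X] r[OF that(2)]
    by simp
  ultimately show ?thesis by (intro exI[of _ ?f]) simp
qed

lemma less_if_div_less: "x < y" if "x div N < y div N" for x y N :: nat
  using that by (meson div_le_mono leD leI)

section \<open>Contraction of a matrix in square cells\<close>

definition contract :: "nat \<Rightarrow> nat \<times> nat \<Rightarrow> nat \<times> nat" where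
  "contract N = (\<lambda>(x, y). (x div N, y div N))"

text \<open>For positive \<open>N\<close> this is the fibre of \<open>contract N\<close> over
  \<open>c\<close>; the product form makes its size evident.\<close>

definition cell :: "nat \<Rightarrow> nat \<times> nat \<Rightarrow> (nat \<times> nat) set" where
  "cell N c = {fst c * N..<fst c * N + N} \<times> {snd c * N..<snd c * N + N}"

lemma mem_cell: "z \<in> cell N (contract N z)" if "N > 0"
  using that by (cases z)
    (auto simp: cell_def contract_def add.commute[of _ N] dividend_less_div_times)

lemma contract_cell: "contract N z = c" if "z \<in> cell N c"
  using that by (cases z, cases c) (auto simp: cell_def contract_def mult.commute[of _ N] intro!: div_nat_eqI)

lemma finite_cell [simp]: "finite (cell N c)"
  by (simp add: cell_def)

lemma card_cell [simp]: "card (cell N c) = N * N"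
  by (simp add: cell_def)

text \<open>For each \<open>j\<close> pick a point of \<open>A\<close> in the cell that
  \<open>j\<close> is sent to: a strict inequality between cell indices forces the same one between
  coordinates, and ties impose nothing.\<close>

lemma embeds_contract:
  assumes "embeds J u v (contract N ` A)"
  shows "embeds J u v A"
proof -
  obtain f g where fg: "\<forall>j\<in>J. (f j, g j) \<in> contract N ` A"
    "\<forall>j\<in>J. \<forall>l\<in>J. (u j < u l \<longrightarrow> f j < f l) \<and> (v j < v l \<longrightarrow> g j < g l)"
    using assms unfolding embeds_def by blast
  have "\<forall>j\<in>J. \<exists>z. z \<in> A \<and> f j = fst z div N \<and> g j = snd z div N"
    using fg(1) by (force simp: contract_def)
  then obtain z where z: "\<forall>j\<in>J. z j \<in> A \<and> f j = fst (z j) div N \<and> g j = snd (z j) div N"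
    by metis
  have "fst (z j) < fst (z l)" if "j \<in> J" "l \<in> J" "u j < u l" for j l
  proof (rule less_if_div_less)
    show "fst (z j) div N < fst (z l) div N" using fg(2) z that by metis
  qed
  moreover have "snd (z j) < snd (z l)" if "j \<in> J" "l \<in> J" "v j < v l" for j l
  proof (rule less_if_div_less)
    show "snd (z j) div N < snd (z l) div N" using fg(2) z that by metis
  qed
  ultimately show ?thesis unfolding embeds_def
    by (intro exI[of _ "fst \<circ> z"] exI[of _ "snd \<circ> z"]) (simp add: z)
qed

section \<open>Cells whose points meet many columns (first coordinates) or many rows\<close>

definition wide_cells :: "nat \<Rightarrow> nat \<Rightarrow> (nat \<times> nat) set \<Rightarrow> (nat \<times> nat) set" where
  "wide_cells N s A = {c \<in> contract N ` A. s < card (fst ` (A \<inter> cell N c))}"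

text \<open>If \<open>card J\<close> cells in one column of cells occupied the same columns, the order of the rows
  could be realised by the choice of the cell and the order of the columns inside the cells.\<close>

lemma card_wide_cells_column:
  assumes J: "finite J" and avoid: "\<not> embeds J u v A" and A: "finite A"
  shows "card {b. (a, b) \<in> wide_cells N (card J) A} \<le> 2 ^ N * card J"
proof -
  let ?W = "{b. (a, b) \<in> wide_cells N (card J) A}"
  \<comment> \<open>The wide cells with first index \<open>a\<close> are sorted by the set of
    columns they occupy, a subset of \<open>N\<close> columns; hence the factor
    \<open>2 ^ N\<close>.\<close>
  define X where "X b = fst ` (A \<inter> cell N (a, b))" for b
  let ?P = "Pow {a * N..<a * N + N}"
  have XP: "X b \<in> ?P" for b by (auto simp: X_def cell_def)
  have finW: "finite ?W"
  proof (rule finite_subset)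
    show "?W \<subseteq> snd ` contract N ` A"
      unfolding wide_cells_def by (metis (no_types, lifting) image_eqI mem_Collect_eq snd_conv subsetI)
  qed (use A in simp)
  have "card {b \<in> ?W. X b = S} \<le> card J" for S
  proof (rule ccontr)
    assume less: "\<not> ?thesis"
    let ?B = "{b \<in> ?W. X b = S}"
    \<comment> \<open>Some cell occupies exactly the columns \<open>S\<close> and is wide, so
      \<open>S\<close> has room for the columns required by \<open>u\<close>.\<close>
    have "?B \<noteq> {}" using less by (metis card.empty le0)
    then have "card J \<le> card S" "S \<in> ?P"
      using XP by (auto simp: wide_cells_def X_def)
    moreover from this have "finite S" by (auto intro: finite_subset)
    ultimately obtain f where f: "\<forall>j\<in>J. f j \<in> S" "\<forall>j\<in>J. \<forall>l\<in>J. u j < u l \<longrightarrow> f j < f l"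
      using ex_monotone_map[OF J, of S u] by blast
    have "finite ?B" using finW by (rule rev_finite_subset) blast
    moreover have "card J \<le> card ?B" using less by linarith
    ultimately obtain h where h: "\<forall>j\<in>J. h j \<in> ?B" "\<forall>j\<in>J. \<forall>l\<in>J. v j < v l \<longrightarrow> h j < h l"
      using ex_monotone_map[OF J, of ?B v] by blast
    \<comment> \<open>Column \<open>f j\<close> is occupied in the cell of height \<open>h j\<close>
      because all cells in \<open>?B\<close> occupy the same columns; the rows inherit their order
      from \<open>h\<close>.\<close>
    have "\<forall>j\<in>J. \<exists>y. (f j, y) \<in> A \<and> y div N = h j"
    proof
      fix j assume j: "j \<in> J"
      have "f j \<in> X (h j)" using f(1) h(1) j by auto
      then obtain y where y: "(f j, y) \<in> A" "(f j, y) \<in> cell N (a, h j)"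
        by (auto simp: X_def)
      show "\<exists>y. (f j, y) \<in> A \<and> y div N = h j"
        using y(1) contract_cell[OF y(2)] by (auto simp: contract_def)
    qed
    then obtain g where g: "\<forall>j\<in>J. (f j, g j) \<in> A \<and> g j div N = h j" by metis
    have "g j < g l" if "j \<in> J" "l \<in> J" "v j < v l" for j l
    proof (rule less_if_div_less)
      show "g j div N < g l div N" using g h(2) that by metis
    qed
    then have "embeds J u v A"
      unfolding embeds_def using f(2) g by (intro exI[of _ f] exI[of _ g]) simp
    with avoid show False by contradiction
  qed
  then have "(\<Sum>S\<in>?P. card {b \<in> ?W. X b = S}) \<le> (\<Sum>S\<in>?P. card J)"
    by (intro sum_mono)
  also have "\<dots> = 2 ^ N * card J" by (simp add: card_Pow)
  finally have "(\<Sum>S\<in>?P. card {b \<in> ?W. X b = S}) \<le> 2 ^ N * card J" .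
  moreover have "card ?W \<le> (\<Sum>S\<in>?P. card {b \<in> ?W. X b = S})"
  proof -
    have "?W = (\<Union>S\<in>?P. {b \<in> ?W. X b = S})" using XP by blast
    then have "card ?W = card (\<Union>S\<in>?P. {b \<in> ?W. X b = S})" by (rule arg_cong)
    also have "\<dots> \<le> (\<Sum>S\<in>?P. card {b \<in> ?W. X b = S})" by (rule card_UN_le) simp
    finally show ?thesis .
  qed
  ultimately show ?thesis by linarith
qed

lemma contract_subset_square:
  assumes "A \<subseteq> {..<q * N} \<times> {..<q * N}"
  shows "contract N ` A \<subseteq> {..<q} \<times> {..<q}"
proof (rule image_subsetI)
  fix z assume "z \<in> A"
  then have "fst z < q * N" "snd z < q * N" using assms by auto
  then show "contract N z \<in> {..<q} \<times> {..<q}"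
    by (simp add: contract_def case_prod_beta less_mult_imp_div_less)
qed

lemma card_wide_cells:
  assumes J: "finite J" and avoid: "\<not> embeds J u v A"
    and A: "A \<subseteq> {..<q * N} \<times> {..<q * N}"
  shows "card (wide_cells N (card J) A) \<le> q * (2 ^ N * card J)"
proof -
  let ?W = "wide_cells N (card J) A"
  have fin: "finite A" using A finite_subset by blast
  have "?W \<subseteq> {..<q} \<times> {..<q}"
    using contract_subset_square[OF A] by (auto simp: wide_cells_def)
  then have W: "?W = (SIGMA a:{..<q}. {b. (a, b) \<in> ?W})"
    and "\<And>a. finite {b. (a, b) \<in> ?W}"
    by (auto intro: finite_subset[of _ "{..<q}"])
  then have "card ?W = (\<Sum>a<q. card {b. (a, b) \<in> ?W})"
    by (subst W, subst card_SigmaI) auto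
  also have "\<dots> \<le> (\<Sum>a<q. 2 ^ N * card J)"
    by (intro sum_mono card_wide_cells_column[OF J avoid fin])
  finally show ?thesis by simp
qed

lemma contract_converse: "contract N ` (A\<inverse>) = (contract N ` A)\<inverse>"
  by (force simp: contract_def)

lemma cell_converse: "cell N (prod.swap c) = (cell N c)\<inverse>"
  by (auto simp: cell_def)

text \<open>Transposition exchanges rows and columns, both of the matrix and of the pattern, so the
  tall cells mirror the wide cells of the converse relation.\<close>

lemma card_tall_cells:
  assumes J: "finite J" and avoid: "\<not> embeds J u v A"
    and A: "A \<subseteq> {..<q * N} \<times> {..<q * N}"
  shows "card {c \<in> contract N ` A. card J < card (snd ` (A \<inter> cell N c))} \<le> q * (2 ^ N * card J)"
proof -
  have "fst ` (A\<inverse> \<inter> cell N (prod.swap c)) = snd ` (A \<inter> cell N c)" for c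
    unfolding cell_converse by force
  moreover have "c \<in> contract N ` A \<longleftrightarrow> prod.swap c \<in> contract N ` (A\<inverse>)" for c
    unfolding contract_converse by (cases c) auto
  ultimately have "{c \<in> contract N ` A. card J < card (snd ` (A \<inter> cell N c))}
      = prod.swap -` wide_cells N (card J) (A\<inverse>)"
    by (auto simp: wide_cells_def)
  also have "card \<dots> = card (wide_cells N (card J) (A\<inverse>))"
    by (rule card_vimage_inj) auto
  also have "\<dots> \<le> q * (2 ^ N * card J)"
    by (rule card_wide_cells[OF J]) (use avoid embeds_converse A in auto)
  finally show ?thesis .
qed

text \<open>A cell that is neither wide nor tall has its points in a product of at most
  \<open>card J\<close> columns and \<open>card J\<close> rows. The other cells hold at most
  \<open>N * N\<close> points each, and there are at most \<open>2 * q * 2 ^ N * card J\<close> of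
  them.\<close>

lemma card_step:
  assumes J: "finite J" and avoid: "\<not> embeds J u v A" and N: "N > 0"
    and A: "A \<subseteq> {..<q * N} \<times> {..<q * N}"
  shows "card A \<le> card J * card J * card (contract N ` A) + 2 * N * N * 2 ^ N * card J * q"
proof -
  let ?s = "card J" and ?C = "contract N ` A"
  let ?W = "wide_cells N ?s A" and ?T = "{c \<in> ?C. ?s < card (snd ` (A \<inter> cell N c))}"
  define B where "B = ?W \<union> ?T"
  have fin: "finite A" using A finite_subset by blast
  have cell_bound: "card (A \<inter> cell N c) \<le> ?s * ?s + (if c \<in> B then N * N else 0)"
    if "c \<in> ?C" for c
  proof (cases "c \<in> B")
    case True
    have "card (A \<inter> cell N c) \<le> N * N"
      using card_mono[of "cell N c" "A \<inter> cell N c"] by simp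
    with True show ?thesis by simp
  next
    case False
    let ?D = "A \<inter> cell N c"
    have "?D \<subseteq> fst ` ?D \<times> snd ` ?D" by force
    then have "card ?D \<le> card (fst ` ?D) * card (snd ` ?D)"
      using card_mono[of "fst ` ?D \<times> snd ` ?D" ?D] fin by (simp add: card_cartesian_product)
    also have "\<dots> \<le> ?s * ?s"
      using False that by (intro mult_mono) (auto simp: wide_cells_def B_def)
    finally show ?thesis using False by simp
  qed
  have "A = (\<Union>c\<in>?C. A \<inter> cell N c)" using mem_cell[OF N] by blast
  then have "card A \<le> (\<Sum>c\<in>?C. card (A \<inter> cell N c))"
    using card_UN_le[of ?C "\<lambda>c. A \<inter> cell N c"] fin by simp
  also have "\<dots> \<le> (\<Sum>c\<in>?C. ?s * ?s + (if c \<in> B then N * N else 0))"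
    by (intro sum_mono cell_bound)
  also have "\<dots> = ?s * ?s * card ?C + N * N * card (?C \<inter> B)"
    using fin by (simp add: sum.distrib sum.If_cases)
  also have "?C \<inter> B = ?W \<union> ?T" by (auto simp: B_def wide_cells_def)
  also have "card (?W \<union> ?T) \<le> q * (2 ^ N * ?s) + q * (2 ^ N * ?s)"
    using card_Un_le[of ?W ?T] card_wide_cells[OF J avoid A] card_tall_cells[OF J avoid A]
    by linarith
  finally show ?thesis by (simp add: algebra_simps)
qed

section \<open>The size and the number of avoiding matrices\<close>

text \<open>The Fueredi--Hajnal conjecture; restricting to powers of the cell size avoids partial cells.\<close>

lemma card_avoiding_le_linear:
  assumes J: "finite J"
  shows "\<exists>K. \<forall>p A. A \<subseteq> {..<(card J * card J + 2) ^ p} \<times> {..<(card J * card J + 2) ^ p} \<longrightarrow>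
    \<not> embeds J u v A \<longrightarrow> card A \<le> K * (card J * card J + 2) ^ p"
proof -
  \<comment> \<open>With \<open>s = card J\<close>, the recursion closes because
    \<open>s * s * K + K \<le> N * K\<close>; moreover \<open>N \<ge> 2\<close> even for empty
    \<open>J\<close>, so the powers of \<open>N\<close> are unbounded.\<close>
  define N where "N = card J * card J + 2"
  \<comment> \<open>\<open>K\<close> dominates the additive constant of \<open>card_step\<close>,
    and its summand 1 covers the one-entry square.\<close>
  define K where "K = 1 + 2 * N * N * 2 ^ N * card J"
  have "card A \<le> K * N ^ p" if "A \<subseteq> {..<N ^ p} \<times> {..<N ^ p}" "\<not> embeds J u v A" for p A
    using that
  proof (induction p arbitrary: A)
    case 0
    then have "card A \<le> card ({..<1::nat} \<times> {..<1::nat})"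
      by (intro card_mono) auto
    then show ?case by (simp add: K_def)
  next
    case (Suc p)
    have A: "A \<subseteq> {..<N ^ p * N} \<times> {..<N ^ p * N}"
      using Suc.prems by (simp add: mult.commute)
    have "card (contract N ` A) \<le> K * N ^ p"
      using Suc.prems(2) embeds_contract[of J u v N A] contract_subset_square[OF A]
      by (intro Suc.IH) auto
    moreover have "card A \<le> card J * card J * card (contract N ` A)
        + 2 * N * N * 2 ^ N * card J * N ^ p"
      by (rule card_step[OF J _ _ A]) (use Suc.prems in \<open>auto simp: N_def\<close>)
    ultimately have "card A \<le> card J * card J * (K * N ^ p) + K * N ^ p"
      unfolding K_def by (smt (verit) add_mono add_mult_distrib le_add2 le_trans mult_le_mono2)
    also have "\<dots> \<le> K * N ^ Suc p" by (simp add: N_def algebra_simps)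
    finally show ?case .
  qed
  then show ?thesis unfolding N_def by blast
qed

text \<open>Induction on \<open>p\<close>: an avoiding matrix contracts to an avoiding one, and once
  its contraction \<open>C\<close> is known, it is a subset of the union of the cells in
  \<open>C\<close>. As \<open>C\<close> has linear size, this leaves only exponentially many
  choices.\<close>

lemma card_avoiding_sets_le:
  fixes u v :: "'i \<Rightarrow> nat"
  assumes J: "finite J"
  shows "\<exists>D N. 2 \<le> N \<and>
    (\<forall>p. card {A. A \<subseteq> {..<N ^ p} \<times> {..<N ^ p} \<and> \<not> embeds J u v A} \<le> D ^ (N ^ p))"
proof -
  define N where "N = card J * card J + 2"
  obtain K where K: "\<And>p A. A \<subseteq> {..<N ^ p} \<times> {..<N ^ p} \<Longrightarrow> \<not> embeds J u v A \<Longrightarrow> card A \<le> K * N ^ p"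
    using card_avoiding_le_linear[OF J, of u v] unfolding N_def by blast
  \<comment> \<open>Per unit of \<open>N ^ p\<close>, at most \<open>K\<close> cells of
    \<open>N * N\<close> entries are open. The base \<open>D\<close> absorbs the resulting factor,
    and its extra factor 2 covers the two matrices in the one-entry square.\<close>
  define E where "E = N * N * K"
  define D :: nat where "D = 2 ^ (E + 1)"
  define M where "M p = {A. A \<subseteq> {..<N ^ p} \<times> {..<N ^ p} \<and> \<not> embeds J u v A}" for p
  have finM: "finite (M p)" for p
    by (rule finite_subset[of _ "Pow ({..<N ^ p} \<times> {..<N ^ p})"]) (auto simp: M_def)
  have fibre: "card {A \<in> M (Suc p). contract N ` A = C} \<le> 2 ^ (E * N ^ p)" if "C \<in> M p" for p C
  proof -
    let ?U = "\<Union>c\<in>C. cell N c"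
    have C: "C \<subseteq> {..<N ^ p} \<times> {..<N ^ p}" "finite C" "card C \<le> K * N ^ p"
      using that K by (auto simp: M_def intro: finite_subset)
    have "card ?U \<le> card C * (N * N)"
      using card_UN_le[OF C(2), of "cell N"] by simp
    also have "\<dots> \<le> E * N ^ p" using C(3) by (simp add: E_def)
    finally have U: "card ?U \<le> E * N ^ p" .
    have "{A \<in> M (Suc p). contract N ` A = C} \<subseteq> Pow ?U"
      using mem_cell[of N] by (auto simp: N_def)
    then have "card {A \<in> M (Suc p). contract N ` A = C} \<le> card (Pow ?U)"
      using C(2) by (intro card_mono) simp_all
    also have "\<dots> = 2 ^ card ?U" using C(2) by (simp add: card_Pow)
    also have "\<dots> \<le> 2 ^ (E * N ^ p)" using U by (intro power_increasing) auto
    finally show ?thesis .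
  qed
  have "card (M p) \<le> D ^ (N ^ p)" for p
  proof (induction p)
    case 0
    have "card (M 0) \<le> card (Pow ({..<1::nat} \<times> {..<1::nat}))"
      by (intro card_mono) (auto simp: M_def)
    also have "\<dots> \<le> D" by (simp add: card_Pow D_def)
    finally show ?case by simp
  next
    case (Suc p)
    have "M (Suc p) = (\<Union>C\<in>M p. {A \<in> M (Suc p). contract N ` A = C})"
    proof -
      have "contract N ` A \<in> M p" if "A \<in> M (Suc p)" for A
        using that embeds_contract[of J u v N A] contract_subset_square[of A "N ^ p" N]
        by (auto simp: M_def mult.commute)
      then show ?thesis by blast
    qed
    then have "card (M (Suc p)) = card (\<Union>C\<in>M p. {A \<in> M (Suc p). contract N ` A = C})"
      by (rule arg_cong)
    also have "\<dots> \<le> (\<Sum>C\<in>M p. card {A \<in> M (Suc p). contract N ` A = C})"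
      by (rule card_UN_le[OF finM])
    also have "\<dots> \<le> card (M p) * 2 ^ (E * N ^ p)"
      using sum_bounded_above[of "M p", OF fibre] by simp
    also have "\<dots> \<le> D ^ (N ^ p) * D ^ (N ^ p)"
    proof (rule mult_le_mono[OF Suc.IH])
      show "2 ^ (E * N ^ p) \<le> D ^ (N ^ p)"
        unfolding D_def power_mult[symmetric] by (intro power_increasing mult_le_mono1) auto
    qed
    also have "\<dots> = D ^ (2 * N ^ p)" by (simp add: mult_2 power_add)
    also have "\<dots> \<le> D ^ (N ^ Suc p)"
      by (intro power_increasing) (auto simp: D_def N_def)
    finally show ?case .
  qed
  then show ?thesis unfolding M_def by (intro exI[of _ D] exI[of _ N]) (simp add: N_def)
qed

subsection \<open>The Stanley--Wilf bound\<close>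

lemma perms_iff: "\<sigma> \<in> perms n \<longleftrightarrow> set \<sigma> = {1..n} \<and> distinct \<sigma>"
  by (auto simp: perms_def permutations_of_set_def)

lemma length_perms: "length \<sigma> = n" if "\<sigma> \<in> perms n"
  using that by (metis perms_iff distinct_card card_atLeastAtMost diff_Suc_1)

lemma finite_perms [simp]: "finite (perms n)"
  by (simp add: perms_def)

lemma finite_Av [simp]: "finite (Av n T)"
  by (simp add: Av_def)

text \<open>The matrix has the letters shifted to start at 0. An embedding yields only implications
  between strict inequalities; they become equivalences because the letters of \<open>\<tau>\<close>
  are distinct.\<close>

lemma contains_pattern_if_embeds_graph:
  assumes "\<tau> \<in> perms m" and "0 \<notin> set \<sigma>"
    and "embeds {..<length \<tau>} id ((!) \<tau>) {(x, \<sigma> ! x - 1) | x. x < length \<sigma>}"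
  shows "contains_pattern \<sigma> \<tau>"
proof -
  let ?m = "length \<tau>"
  obtain f g where emb: "\<forall>j\<in>{..<?m}. (f j, g j) \<in> {(x, \<sigma> ! x - 1) | x. x < length \<sigma>}"
    "\<forall>j\<in>{..<?m}. \<forall>l\<in>{..<?m}. (id j < id l \<longrightarrow> f j < f l) \<and> (\<tau> ! j < \<tau> ! l \<longrightarrow> g j < g l)"
    using assms(3) unfolding embeds_def by blast
  have fg: "f j < length \<sigma> \<and> g j = \<sigma> ! f j - 1" if "j < ?m" for j
    using emb(1) that by blast
  have f_mono: "f j < f l" if "j < ?m" "l < ?m" "j < l" for j l
    using emb(2) that by simp
  have g_mono: "g j < g l" if "j < ?m" "l < ?m" "\<tau> ! j < \<tau> ! l" for j l
    using emb(2) that by simp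
  have pos: "\<sigma> ! f j > 0" if "j < ?m" for j
    using fg[OF that] assms(2) nth_mem[of "f j" \<sigma>] by (metis gr0I)
  have less: "\<sigma> ! f j < \<sigma> ! f l" if "j < ?m" "l < ?m" "\<tau> ! j < \<tau> ! l" for j l
    using g_mono[OF that] fg[OF that(1)] fg[OF that(2)] by linarith
  have "\<sigma> ! f j < \<sigma> ! f l \<longleftrightarrow> \<tau> ! j < \<tau> ! l" if "j < ?m" "l < ?m" for j l
  proof (cases "j = l")
    case False
    then have "\<tau> ! j \<noteq> \<tau> ! l"
      using assms(1) that by (simp add: perms_iff nth_eq_iff_index_eq)
    then show ?thesis using less[OF that] less[OF that(2,1)] by (meson less_asym nat_neq_iff)
  qed simp
  then show ?thesis
    unfolding contains_pattern_def
    by (intro exI[of _ f]) (use fg f_mono in \<open>auto simp: strict_mono_on_def\<close>)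
qed

text \<open>The least suitable exponent works. A permutation matrix of size \<open>n\<close> thus
  fits into a square whose side is a power of \<open>N\<close>, at the cost of a constant
  factor.\<close>

lemma ex_power_between:
  fixes n N :: nat
  assumes "2 \<le> N" "1 \<le> n"
  shows "\<exists>p. n \<le> N ^ p \<and> N ^ p \<le> N * n"
proof -
  have ex: "\<exists>p. n \<le> N ^ p"
    using less_exp[of n] power_mono[OF assms(1), of n] by (intro exI[of _ n]) linarith
  define p where "p = (LEAST p. n \<le> N ^ p)"
  have p: "n \<le> N ^ p" unfolding p_def using ex by (rule LeastI_ex)
  have "N ^ p \<le> N * n"
  proof (cases p)
    case 0
    then show ?thesis using assms by simp
  next
    case (Suc r)
    then have "\<not> n \<le> N ^ r" using not_less_Least[of r "\<lambda>p. n \<le> N ^ p"] by (simp add: p_def)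
    then show ?thesis using Suc by simp
  qed
  with p show ?thesis by blast
qed

text \<open>Avoiding \<open>T\<close> implies avoiding \<open>\<tau>\<close>. Permutations are
  counted by their matrices, which are avoiding subsets of a square of side at most
  \<open>N * n\<close>.\<close>

theorem stanley_wilf:
  assumes "\<tau> \<in> perms m" "\<tau> \<in> T"
  shows "\<exists>C. \<forall>n\<ge>1. card (Av n T) \<le> C ^ n"
proof -
  let ?e = "embeds {..<length \<tau>} id ((!) \<tau>)"
  obtain D N where N: "2 \<le> N" and D: "\<And>p. card {A. A \<subseteq> {..<N ^ p} \<times> {..<N ^ p} \<and> \<not> ?e A} \<le> D ^ (N ^ p)"
    using card_avoiding_sets_le[of "{..<length \<tau>}" id "(!) \<tau>"] by auto
  have "card (Av n T) \<le> (Suc D ^ N) ^ n" if "n \<ge> 1" for n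
  proof -
    obtain p where p: "n \<le> N ^ p" "N ^ p \<le> N * n" using ex_power_between[OF N \<open>n \<ge> 1\<close>] by blast
    let ?M = "{A. A \<subseteq> {..<N ^ p} \<times> {..<N ^ p} \<and> \<not> ?e A}"
    let ?G = "\<lambda>\<sigma>. {(x, \<sigma> ! x - 1) | x. x < length \<sigma>}"
    have Av: "length \<sigma> = n" "set \<sigma> = {1..n}" "\<not> contains_pattern \<sigma> \<tau>" if "\<sigma> \<in> Av n T" for \<sigma>
      using that assms(2) length_perms[of \<sigma> n] by (auto simp: Av_def avoids_all_def perms_iff)
    have letter: "1 \<le> \<sigma> ! x \<and> \<sigma> ! x \<le> n" if "\<sigma> \<in> Av n T" "x < n" for \<sigma> x
      using Av(1,2)[OF that(1)] nth_mem[of x \<sigma>] that(2) by auto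
    have inj: "inj_on ?G (Av n T)"
    proof (intro inj_onI nth_equalityI)
      fix \<sigma> \<rho> x assume *: "\<sigma> \<in> Av n T" "\<rho> \<in> Av n T" "?G \<sigma> = ?G \<rho>" "x < length \<sigma>"
      then have "(x, \<sigma> ! x - 1) \<in> ?G \<rho>" by blast
      then show "\<sigma> ! x = \<rho> ! x" using letter[of \<sigma> x] letter[of \<rho> x] * Av(1) by fastforce
    qed (use Av(1) in auto)
    have sub: "?G ` Av n T \<subseteq> ?M"
    proof (rule image_subsetI)
      fix \<sigma> assume \<sigma>: "\<sigma> \<in> Av n T"
      have "\<not> ?e (?G \<sigma>)"
        using contains_pattern_if_embeds_graph[OF assms(1), of \<sigma>] Av(2,3)[OF \<sigma>] by auto
      moreover have "?G \<sigma> \<subseteq> {..<N ^ p} \<times> {..<N ^ p}"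
        using letter[OF \<sigma>] Av(1)[OF \<sigma>] p(1) by fastforce
      ultimately show "?G \<sigma> \<in> ?M" by blast
    qed
    have fin: "finite ?M"
      by (rule finite_subset[of _ "Pow ({..<N ^ p} \<times> {..<N ^ p})"]) auto
    have "card (Av n T) \<le> card ?M" by (rule card_inj_on_le[OF inj sub fin])
    also have "\<dots> \<le> D ^ (N ^ p)" by (rule D)
    \<comment> \<open>A positive base makes the power monotone in the exponent.\<close>
    also have "\<dots> \<le> Suc D ^ (N ^ p)" by (intro power_mono) auto
    also have "\<dots> \<le> Suc D ^ (N * n)" using p(2) by (intro power_increasing) auto
    finally show ?thesis by (simp add: power_mult)
  qed
  then show ?thesis by blast
qed

subsection \<open>Direct sums\<close>

lemma perms_nth: "w ! i \<in> {1..n}" if "w \<in> perms n" "i < n"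
  using that length_perms[OF that(1)] nth_mem[of i w] by (metis perms_iff)

lemma length_direct_sum [simp]: "length (direct_sum \<rho> \<mu>) = length \<rho> + length \<mu>"
  by (simp add: direct_sum_def)

lemma direct_sum_nth:
  "i < length \<rho> \<Longrightarrow> direct_sum \<rho> \<mu> ! i = \<rho> ! i"
  "length \<rho> \<le> i \<Longrightarrow> i < length \<rho> + length \<mu> \<Longrightarrow>
    direct_sum \<rho> \<mu> ! i = \<mu> ! (i - length \<rho>) + length \<rho>"
  by (auto simp: direct_sum_def nth_append)

lemma direct_sum_perms:
  assumes "\<rho> \<in> perms p" "\<mu> \<in> perms q"
  shows "direct_sum \<rho> \<mu> \<in> perms (p + q)"
proof -
  have len: "length \<rho> = p" "length \<mu> = q" using assms length_perms by auto
  have "(\<lambda>x. x + p) ` {1..q} = {p + 1..p + q}"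
    by (simp add: add.commute)
  then have set: "set (direct_sum \<rho> \<mu>) = {1..p + q}"
    using assms len by (auto simp: direct_sum_def perms_iff)
  \<comment> \<open>A word of length \<open>p + q\<close> with \<open>p + q\<close> different
    letters repeats none.\<close>
  moreover have "distinct (direct_sum \<rho> \<mu>)"
    by (rule card_distinct) (simp add: set len)
  ultimately show ?thesis by (simp add: perms_iff)
qed

text \<open>The letters of the prefix must be exactly \<open>1\<close> to \<open>t\<close>, so the
  cut after the first \<open>t\<close> letters exhibits \<open>\<tau>\<close> as a direct
  sum.\<close>

lemma sum_decomposable_if_lower_prefix:
  assumes \<tau>: "\<tau> \<in> perms m" and t: "1 \<le> t" "t < m"
    and low: "\<And>j l. j < t \<Longrightarrow> t \<le> l \<Longrightarrow> l < m \<Longrightarrow> \<tau> ! j < \<tau> ! l"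
  shows "\<not> sum_indecomposable \<tau>"
proof -
  let ?A = "set (take t \<tau>)" and ?B = "set (drop t \<tau>)"
  have len: "length \<tau> = m" and dist: "distinct \<tau>" and set: "set \<tau> = {1..m}"
    using \<tau> length_perms by (auto simp: perms_iff)
  have AB: "?A \<union> ?B = {1..m}" "?A \<inter> ?B = {}"
    using set dist set_take_disj_set_drop_if_distinct[of \<tau> t t]
    by (auto simp flip: set_append)
  have less: "a < b" if "a \<in> ?A" "b \<in> ?B" for a b
    using that low len t by (force simp: in_set_conv_nth)
  have cardA: "card ?A = t" using dist len t by (simp add: distinct_card)
  \<comment> \<open>The \<open>t\<close> letters of the prefix are positive and smaller than
    \<open>b\<close>, which leaves no room for \<open>b \<le> t\<close>.\<close>
  have "b > t" if b: "b \<in> ?B" for b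
  proof -
    have "?A \<subseteq> {1..<b}" using less[OF _ b] AB(1) by force
    then have "t \<le> b - 1" using card_mono[of "{1..<b}" ?A] cardA by simp
    moreover have "1 \<le> b" using b AB(1) by auto
    ultimately show ?thesis by linarith
  qed
  then have "{1..t} \<inter> ?B = {}" by force
  then have "{1..t} \<subseteq> ?A" using AB(1) t by force
  then have A: "{1..t} = ?A" by (intro card_subset_eq) (simp_all add: cardA)
  have "?B = {1..m} - ?A" using AB by blast
  also have "\<dots> = {t + 1..m}" unfolding A[symmetric] by auto
  finally have B: "?B = {t + 1..m}" .
  define \<mu> where "\<mu> = map (\<lambda>x. x - t) (drop t \<tau>)"
  have "map (\<lambda>x. x + t) \<mu> = drop t \<tau>"
    unfolding \<mu>_def map_map by (rule map_idI) (simp add: B)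
  then have "\<tau> = direct_sum (take t \<tau>) \<mu>"
    using len t by (simp add: direct_sum_def)
  moreover have "take t \<tau> \<in> perms t" using dist unfolding perms_iff A by simp
  moreover have "\<mu> \<in> perms (m - t)"
  proof -
    have "(\<lambda>x. x - t) ` {t + 1..m} = {1..m - t}"
    proof
      show "{1..m - t} \<subseteq> (\<lambda>x. x - t) ` {t + 1..m}"
      proof
        fix y assume "y \<in> {1..m - t}"
        then show "y \<in> (\<lambda>x. x - t) ` {t + 1..m}" by (intro image_eqI[of _ _ "y + t"]) auto
      qed
    qed auto
    moreover have "inj_on (\<lambda>x. x - t) {t + 1..m}" by (auto simp: inj_on_def)
    ultimately show ?thesis using B dist by (simp add: perms_iff \<mu>_def distinct_map)
  qed
  ultimately show ?thesis
    unfolding sum_indecomposable_def not_not using t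
    by (intro exI[of _ t] exI[of _ "m - t"] conjI bexI) auto
qed

lemma contains_patternI:
  assumes "\<And>j l. j < l \<Longrightarrow> l < length \<tau> \<Longrightarrow> i j < i l"
    and "\<And>j. j < length \<tau> \<Longrightarrow> i j < length \<sigma>"
    and "\<And>j l. j < length \<tau> \<Longrightarrow> l < length \<tau> \<Longrightarrow> \<sigma> ! i j < \<sigma> ! i l \<longleftrightarrow> \<tau> ! j < \<tau> ! l"
  shows "contains_pattern \<sigma> \<tau>"
  unfolding contains_pattern_def
  by (rule exI[of _ i]) (use assms in \<open>auto simp: strict_mono_on_def\<close>)

text \<open>An occurrence within one summand is an occurrence there. One that straddles the cut
  would place a proper nonempty prefix of \<open>\<tau>\<close> below the rest and so decompose
  \<open>\<tau>\<close>.\<close>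

lemma contains_pattern_direct_sum:
  assumes \<sigma>: "\<sigma> \<in> perms p" and \<rho>: "\<rho> \<in> perms q" and \<tau>: "\<tau> \<in> perms m"
    and ind: "sum_indecomposable \<tau>"
    and con: "contains_pattern (direct_sum \<sigma> \<rho>) \<tau>"
  shows "contains_pattern \<sigma> \<tau> \<or> contains_pattern \<rho> \<tau>"
proof -
  let ?w = "direct_sum \<sigma> \<rho>"
  note len = length_perms[OF \<sigma>] length_perms[OF \<rho>] length_perms[OF \<tau>]
  obtain i where mono: "\<And>j l. j < l \<Longrightarrow> l < m \<Longrightarrow> i j < i l"
    and range: "\<And>j. j < m \<Longrightarrow> i j < p + q"
    and ord: "\<And>j l. j < m \<Longrightarrow> l < m \<Longrightarrow> ?w ! i j < ?w ! i l \<longleftrightarrow> \<tau> ! j < \<tau> ! l"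
  proof -
    from con obtain i where "strict_mono_on {..<m} i" "i ` {..<m} \<subseteq> {..<p + q}"
      "\<forall>j<m. \<forall>l<m. ?w ! i j < ?w ! i l \<longleftrightarrow> \<tau> ! j < \<tau> ! l"
      unfolding contains_pattern_def len length_direct_sum by blast
    then show thesis by (intro that[of i]) (auto simp: strict_mono_on_def)
  qed
  \<comment> \<open>Since \<open>i\<close> is increasing, the pattern positions sent into the first
    summand form an initial segment; \<open>t\<close> is its length.\<close>
  define t where "t = card {j. j < m \<and> i j < p}"
  have down: "i j < p" if "j \<le> l" "l < m" "i l < p" for j l
    using mono[of j l] that by (cases "j = l") auto
  have t: "j < t \<longleftrightarrow> i j < p" if "j < m" for j
  proof
    assume "i j < p"
    then have "{..j} \<subseteq> {j. j < m \<and> i j < p}" using down[of _ j] that by auto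
    from card_mono[OF _ this] show "j < t" by (simp add: t_def)
  next
    assume jt: "j < t"
    show "i j < p"
    proof (rule ccontr)
      assume "\<not> i j < p"
      then have "{j. j < m \<and> i j < p} \<subseteq> {..<j}" using down[of j] by (auto simp: not_less[symmetric])
      from card_mono[OF _ this] jt show False by (simp add: t_def)
    qed
  qed
  have "t \<le> m" using card_mono[of "{..<m}" "{j. j < m \<and> i j < p}"] by (auto simp: t_def)
  then consider "t = m" | "t = 0" | "1 \<le> t" "t < m" by linarith
  then show ?thesis
  proof cases
    case 1
    have "contains_pattern \<sigma> \<tau>"
    proof (rule contains_patternI[of _ i])
      fix j l assume "j < length \<tau>" "l < length \<tau>"
      then show "\<sigma> ! i j < \<sigma> ! i l \<longleftrightarrow> \<tau> ! j < \<tau> ! l"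
        using ord[of j l] t[of j] t[of l] 1 len by (simp add: direct_sum_nth)
    qed (use mono t 1 len in auto)
    then show ?thesis ..
  next
    case 2
    have ge: "p \<le> i j" if "j < m" for j using t[OF that] 2 by simp
    have "contains_pattern \<rho> \<tau>"
    proof (rule contains_patternI[of _ "\<lambda>j. i j - p"])
      fix j l assume "j < length \<tau>" "l < length \<tau>"
      then show "\<rho> ! (i j - p) < \<rho> ! (i l - p) \<longleftrightarrow> \<tau> ! j < \<tau> ! l"
        using ord[of j l] ge[of j] ge[of l] range[of j] range[of l] len
        by (simp add: direct_sum_nth)
    next
      fix j l assume "j < l" "l < length \<tau>"
      then show "i j - p < i l - p" using mono[of j l] ge[of j] len by simp
    next
      fix j assume "j < length \<tau>"
      then show "i j - p < length \<rho>" using range[of j] ge[of j] len by simp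
    qed
    then show ?thesis ..
  next
    case 3
    have "\<tau> ! j < \<tau> ! l" if "j < t" "t \<le> l" "l < m" for j l
    proof -
      have ij: "i j < p" and il: "p \<le> i l" "i l < p + q"
        using t[of j] t[of l] that range[of l] by auto
      have "\<sigma> ! i j \<in> {1..p}" by (rule perms_nth[OF \<sigma> ij])
      moreover have "\<rho> ! (i l - p) \<in> {1..q}" using il by (intro perms_nth[OF \<rho>]) simp
      ultimately have "?w ! i j < ?w ! i l" using ij il len by (simp add: direct_sum_nth)
      then show ?thesis using ord that by simp
    qed
    then show ?thesis using sum_decomposable_if_lower_prefix[OF \<tau> 3] ind by blast
  qed
qed

subsection \<open>Heaps as words\<close>

text \<open>Heaps are encoded by their words so that they can be joined to permutations as lists;
  the shift by one arises because vertices are numbered from 1.\<close>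

definition heap_words :: "nat \<Rightarrow> nat \<Rightarrow> nat list set \<Rightarrow> nat list set" where
  "heap_words k n T =
    {w \<in> Av n T. \<forall>i\<in>{1..n}. \<forall>j\<in>tree_children k n i. w ! (i - 1) < w ! (j - 1)}"

lemma heap_perm_nth: "heap_perm n h ! (i - 1) = h i" if "i \<in> {1..n}"
  using that by (auto simp: heap_perm_def simp del: upt_Suc)

text \<open>A labeling is recovered from its word because it is extensional; conversely, a word that
  is a permutation gives a bijective labeling.\<close>

lemma bij_betw_heap_perm:
  "bij_betw (heap_perm n) (avoiding_heaps k n T) (heap_words k n T)"
proof (rule bij_betw_imageI)
  show "inj_on (heap_perm n) (avoiding_heaps k n T)"
  proof (rule inj_onI)
    fix g h assume "g \<in> avoiding_heaps k n T" "h \<in> avoiding_heaps k n T"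
      and eq: "heap_perm n g = heap_perm n h"
    then have "g \<in> {1..n} \<rightarrow>\<^sub>E {1..n}" "h \<in> {1..n} \<rightarrow>\<^sub>E {1..n}"
      by (auto simp: avoiding_heaps_def kary_heaps_def)
    then show "g = h" by (rule PiE_ext) (metis eq heap_perm_nth)
  qed
  have child: "j \<in> {1..n}" if "j \<in> tree_children k n i" for i j
    using that by (auto simp: tree_children_def)
  have heap_perm: "heap_perm n h \<in> perms n \<longleftrightarrow> bij_betw h {1..n} {1..n}" for h
    by (auto simp: heap_perm_def perms_iff distinct_map bij_betw_def atLeastLessThanSuc_atLeastAtMost
        simp del: upt_Suc)
  show "heap_perm n ` avoiding_heaps k n T = heap_words k n T"
  proof (intro equalityI subsetI)
    fix w assume "w \<in> heap_perm n ` avoiding_heaps k n T"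
    then show "w \<in> heap_words k n T"
      using child
      by (auto simp: avoiding_heaps_def kary_heaps_def heap_words_def Av_def heap_perm heap_perm_nth
          simp del: One_nat_def)
  next
    fix w assume w: "w \<in> heap_words k n T"
    define h where "h = restrict (\<lambda>i. w ! (i - 1)) {1..n}"
    have wp: "w \<in> perms n" using w by (simp add: heap_words_def Av_def)
    have eq: "heap_perm n h = w"
      using length_perms[OF wp]
      by (intro nth_equalityI) (auto simp: heap_perm_def h_def simp del: upt_Suc)
    moreover have "h \<in> avoiding_heaps k n T"
    proof -
      have bij: "bij_betw h {1..n} {1..n}" using wp eq heap_perm by metis
      then have "h \<in> {1..n} \<rightarrow>\<^sub>E {1..n}" by (auto simp: h_def bij_betw_def)
      with bij w eq child show ?thesis
        by (auto simp: avoiding_heaps_def kary_heaps_def heap_words_def Av_def h_def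
            simp del: One_nat_def)
    qed
    ultimately show "w \<in> heap_perm n ` avoiding_heaps k n T" by blast
  qed
qed

text \<open>The bound on \<open>q\<close> makes the parent of each appended vertex one of the first \<open>p\<close> vertices,
  so the order of the appended letters is not constrained by the tree.\<close>

lemma direct_sum_heap_words:
  assumes k: "k \<ge> 1" and q: "p + q \<le> k * p + 1"
    and T: "\<And>\<tau>. \<tau> \<in> T \<Longrightarrow> (\<exists>m. \<tau> \<in> perms m) \<and> sum_indecomposable \<tau>"
    and \<sigma>: "\<sigma> \<in> heap_words k p T" and \<rho>: "\<rho> \<in> Av q T"
  shows "direct_sum \<sigma> \<rho> \<in> heap_words k (p + q) T"
proof -
  let ?w = "direct_sum \<sigma> \<rho>"
  have perms: "\<sigma> \<in> perms p" "\<rho> \<in> perms q" using \<sigma> \<rho> by (auto simp: heap_words_def Av_def)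
  note len = length_perms[OF perms(1)] length_perms[OF perms(2)]
  have "avoids_all ?w T"
    unfolding avoids_all_def
  proof
    fix \<tau> assume \<tau>: "\<tau> \<in> T"
    then obtain m where m: "\<tau> \<in> perms m" "sum_indecomposable \<tau>" using T by blast
    show "\<not> contains_pattern ?w \<tau>"
      using contains_pattern_direct_sum[OF perms m] \<sigma> \<rho> \<tau>
      by (auto simp: heap_words_def Av_def avoids_all_def)
  qed
  moreover have "?w ! (i - 1) < ?w ! (j - 1)"
    if i: "i \<in> {1..p + q}" and j: "j \<in> tree_children k (p + q) i" for i j
  proof -
    have ki: "k * (i - 1) + 2 \<le> j" and "j \<le> k * i + 1" "j \<le> p + q"
      using j by (auto simp: tree_children_def)
    have "1 * (i - 1) \<le> k * (i - 1)" using k by (rule mult_le_mono1)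
    then have ij: "i < j" using ki by linarith
    have "i \<le> p"
    proof (rule ccontr)
      assume "\<not> i \<le> p"
      then have "k * p \<le> k * (i - 1)" by (intro mult_le_mono2) simp
      with ki q \<open>j \<le> p + q\<close> show False by linarith
    qed
    then have ip: "i - 1 < p" using i by simp
    show ?thesis
    proof (cases "j \<le> p")
      case True
      then have "j \<in> tree_children k p i" using j by (simp add: tree_children_def)
      then have "\<sigma> ! (i - 1) < \<sigma> ! (j - 1)"
        using \<sigma> \<open>i \<le> p\<close> i by (auto simp: heap_words_def)
      moreover have "j - 1 < p" using True ij by simp
      ultimately show ?thesis using ip len by (simp add: direct_sum_nth)
    next
      \<comment> \<open>An appended letter exceeds \<open>p\<close>, hence also the label of its
        parent.\<close>
      case False
      then have "j - 1 - p < q" "p \<le> j - 1" "j - 1 < p + q" using \<open>j \<le> p + q\<close> by auto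
      moreover have "\<sigma> ! (i - 1) \<in> {1..p}" by (rule perms_nth[OF perms(1) ip])
      moreover have "\<rho> ! (j - 1 - p) \<in> {1..q}" by (rule perms_nth[OF perms(2) \<open>j - 1 - p < q\<close>])
      ultimately show ?thesis using ip len by (simp add: direct_sum_nth)
    qed
  qed
  ultimately show ?thesis
    using direct_sum_perms[OF perms] by (simp add: heap_words_def Av_def)
qed

text \<open>All words in \<open>heap_words k p T\<close> have length \<open>p\<close>, so the direct
  sum determines both summands.\<close>

lemma card_heap_words_add:
  assumes "k \<ge> 1" "p + q \<le> k * p + 1"
    and "\<And>\<tau>. \<tau> \<in> T \<Longrightarrow> (\<exists>m. \<tau> \<in> perms m) \<and> sum_indecomposable \<tau>"
  shows "card (heap_words k p T) * card (Av q T) \<le> card (heap_words k (p + q) T)"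
proof -
  have "inj_on (\<lambda>(\<sigma>, \<rho>). direct_sum \<sigma> \<rho>) (heap_words k p T \<times> Av q T)"
  proof (rule inj_onI, clarsimp)
    fix \<sigma> \<rho> \<sigma>' \<rho>'
    assume w: "\<sigma> \<in> heap_words k p T" "\<sigma>' \<in> heap_words k p T"
      and eq: "direct_sum \<sigma> \<rho> = direct_sum \<sigma>' \<rho>'"
    then have "length \<sigma> = length \<sigma>'"
      by (auto simp: heap_words_def Av_def dest!: length_perms)
    then show "\<sigma> = \<sigma>' \<and> \<rho> = \<rho>'"
      using eq by (auto simp: direct_sum_def inj_map_eq_map inj_def)
  qed
  moreover have "(\<lambda>(\<sigma>, \<rho>). direct_sum \<sigma> \<rho>) ` (heap_words k p T \<times> Av q T)
      \<subseteq> heap_words k (p + q) T"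
    using direct_sum_heap_words[OF assms] by auto
  moreover have "finite (heap_words k (p + q) T)"
    by (simp add: heap_words_def)
  ultimately show ?thesis
    using card_inj_on_le by (metis card_cartesian_product)
qed

subsection \<open>The growth rates\<close>

text \<open>As in Fekete's lemma, blocks of a fixed length \<open>m\<close> are appended to a
  prefix, so the lower limit for \<open>h\<close> is at least every \<open>r m\<close>. Since
  \<open>h \<le> a\<close>, both sequences are squeezed to the supremum of the \<open>r m\<close>,
  which \<open>bound\<close> makes finite.\<close>

lemma common_growth_rate:
  fixes a h :: "nat \<Rightarrow> nat"
  assumes le: "\<And>n. h n \<le> a n"
    and one: "h 1 \<ge> 1"
    and add: "\<And>p q. 1 \<le> q \<Longrightarrow> q \<le> p \<Longrightarrow> h p * a q \<le> h (p + q)"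
    and bound: "\<And>n. n \<ge> 1 \<Longrightarrow> a n \<le> C ^ n"
  shows "\<exists>L::real. (\<lambda>n. real (a n) powr (1 / real n)) \<longlonglongrightarrow> L \<and>
    (\<lambda>n. real (h n) powr (1 / real n)) \<longlonglongrightarrow> L"
proof -
  define r where "r n = real (a n) powr (1 / real n)" for n
  define L where "L = (SUP n\<in>{1..}. r n)"
  have r_le: "r n \<le> real C" if "n \<ge> 1" for n
  proof -
    have "r n \<le> (real C ^ n) powr (1 / real n)"
      unfolding r_def using bound[OF that]
      by (intro powr_mono2) (simp_all flip: of_nat_power)
    also have "\<dots> = real C"
      using that by (cases "C = 0") (simp_all add: powr_powr flip: powr_realpow)
    finally show ?thesis .
  qed
  then have bdd: "bdd_above (r ` {1..})" by (intro bdd_aboveI2[of _ _ "real C"]) auto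
  have r_le_L: "r n \<le> L" if "n \<ge> 1" for n
    unfolding L_def using that by (intro cSUP_upper bdd) auto
  have h_pos: "h n \<ge> 1" if "n \<ge> 1" for n
    using that
  proof (induction n rule: dec_induct)
    case (step n)
    have "1 * 1 \<le> h n * a 1" using step.IH one le[of 1] by (intro mult_le_mono) linarith+
    moreover have "h n * a 1 \<le> h (Suc n)" using add[of 1 n] step.hyps by simp
    ultimately show ?case by linarith
  qed (rule one)
  \<comment> \<open>The prefix of length \<open>t \<ge> m\<close> keeps the heap at least as long as
    each block appended to it, as \<open>add\<close> requires.\<close>
  have block: "a m ^ q \<le> h (q * m + t)" if "m \<ge> 1" "t \<ge> m" for m q t
  proof (induction q)
    case 0
    then show ?case using h_pos[of t] that by simp
  next
    case (Suc q)
    have "a m ^ Suc q \<le> h (q * m + t) * a m" using Suc by simp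
    also have "\<dots> \<le> h (Suc q * m + t)" using add[of m "q * m + t"] that by (simp add: add_ac)
    finally show ?case .
  qed
  \<comment> \<open>For fixed \<open>m\<close> the second factor tends to 1 as \<open>n\<close>
    grows.\<close>
  have lower: "r m * r m powr (- (2 * real m / real n)) \<le> real (h n) powr (1 / real n)"
    if m: "m \<ge> 1" and n: "n \<ge> 2 * m" for m n
  proof -
    have am: "a m \<ge> 1" using h_pos[OF m] le[of m] by linarith
    then have rm: "r m \<ge> 1" by (simp add: r_def ge_one_powr_ge_zero)
    have rpow: "r m powr real m = real (a m)" using am m by (simp add: r_def powr_powr)
    \<comment> \<open>One block length is held back, so that the prefix has length between
      \<open>m\<close> and \<open>2 * m - 1\<close>; the blocks then cover more than
      \<open>n - 2 * m\<close> letters.\<close>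
    define q where "q = (n - m) div m"
    have qm: "q * m + ((n - m) mod m + m) = n" using n by (simp add: q_def)
    have "(n - m) mod m < m" using m by simp
    then have "n - 2 * m \<le> q * m" using qm by linarith
    then have "real n - 2 * real m \<le> real m * real q"
      by (metis (no_types, lifting) mult.commute n of_nat_diff of_nat_le_iff of_nat_mult of_nat_numeral)
    then have "r m powr (real n - 2 * real m) \<le> r m powr (real m * real q)"
      using rm by (intro powr_mono)
    also have "\<dots> = real (a m ^ q)"
      using am by (simp add: rpow powr_realpow flip: powr_powr)
    also have "\<dots> \<le> real (h n)" using block[OF m, of "(n - m) mod m + m" q] qm by (simp del: of_nat_power)
    finally have "(r m powr (real n - 2 * real m)) powr (1 / real n) \<le> real (h n) powr (1 / real n)"
      by (intro powr_mono2) auto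
    moreover have "(r m powr (real n - 2 * real m)) powr (1 / real n)
        = r m * r m powr (- (2 * real m / real n))"
    proof -
      have "(real n - 2 * real m) * (1 / real n) = 1 + - (2 * real m / real n)"
        using m n by (simp add: field_simps)
      then show ?thesis using rm unfolding powr_powr by (simp only: powr_add) simp
    qed
    ultimately show ?thesis by simp
  qed
  have h_le: "real (h n) powr (1 / real n) \<le> r n" for n
    unfolding r_def using le[of n] by (intro powr_mono2) auto
  have lim_h: "(\<lambda>n. real (h n) powr (1 / real n)) \<longlonglongrightarrow> L"
  proof (rule order_tendstoI)
    \<comment> \<open>Some \<open>r m\<close> already exceeds \<open>x\<close>; with this
      \<open>m\<close> fixed, \<open>lower\<close> carries the inequality over to \<open>h n\<close>
      for large \<open>n\<close>.\<close>
    fix x assume "x < L"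
    then obtain m where m: "m \<ge> 1" "x < r m"
      unfolding L_def using less_cSUP_iff[OF _ bdd] by auto
    have "a m \<ge> 1" using h_pos[OF m(1)] le[of m] by linarith
    then have "r m > 0" by (simp add: r_def)
    have "(\<lambda>n. 2 * real m / real n) \<longlonglongrightarrow> 0" by (rule lim_const_over_n)
    then have "(\<lambda>n. r m * r m powr (- (2 * real m / real n))) \<longlonglongrightarrow> r m * r m powr (- 0)"
      using \<open>r m > 0\<close> by (intro tendsto_intros) auto
    then have "\<forall>\<^sub>F n in sequentially. x < r m * r m powr (- (2 * real m / real n))"
      using m(2) \<open>r m > 0\<close> by (intro order_tendstoD) auto
    then show "\<forall>\<^sub>F n in sequentially. x < real (h n) powr (1 / real n)"
      using eventually_ge_at_top[of "2 * m"]
      by eventually_elim (use lower[OF m(1)] in force)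
  next
    fix x assume "L < x"
    show "\<forall>\<^sub>F n in sequentially. real (h n) powr (1 / real n) < x"
      using eventually_ge_at_top[of 1]
      by eventually_elim (use h_le r_le_L \<open>L < x\<close> in \<open>meson le_less_trans\<close>)
  qed
  moreover have "r \<longlonglongrightarrow> L"
  proof (rule tendsto_sandwich[OF _ _ lim_h tendsto_const])
    show "\<forall>\<^sub>F n in sequentially. real (h n) powr (1 / real n) \<le> r n"
      using h_le by simp
    show "\<forall>\<^sub>F n in sequentially. r n \<le> L"
      using eventually_ge_at_top[of 1] by eventually_elim (rule r_le_L)
  qed
  ultimately show ?thesis unfolding r_def by blast
qed

text \<open>Such a pattern imposes no order condition, so the first position serves as an
  occurrence. This settles the degenerate case in which no heap with one vertex is available to
  start the growth argument.\<close>

lemma Av_eq_empty: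
  assumes "\<tau> \<in> T" "length \<tau> \<le> 1" "n \<ge> 1"
  shows "Av n T = {}"
proof -
  have "contains_pattern \<sigma> \<tau>" if "\<sigma> \<in> perms n" for \<sigma>
  proof (rule contains_patternI[of _ "\<lambda>_. 0"])
    fix j l assume "j < length \<tau>" "l < length \<tau>"
    then have "j = l" using assms(2) by linarith
    then show "\<sigma> ! 0 < \<sigma> ! 0 \<longleftrightarrow> \<tau> ! j < \<tau> ! l" by simp
  qed (use length_perms[OF that] assms(2,3) in auto)
  then show ?thesis using assms(1) by (auto simp: Av_def avoids_all_def)
qed

theorem theorem2p1:
  fixes k :: nat and I :: "nat set" and m :: "nat \<Rightarrow> nat" and \<tau> :: "nat \<Rightarrow> nat list"
  assumes "k \<ge> 2"
    and "(\<exists>r\<ge>1. I = {1..r}) \<or> I = {1..}"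
    and "\<And>i. i \<in> I \<Longrightarrow> m i \<ge> 1"
    and "\<And>i. i \<in> I \<Longrightarrow> \<tau> i \<in> perms (m i)"
    and "\<And>i. i \<in> I \<Longrightarrow> sum_indecomposable (\<tau> i)"
  shows "\<exists>L::real.
    (\<lambda>n. real (card (Av n (\<tau> ` I))) powr (1 / real n)) \<longlonglongrightarrow> L \<and>
    (\<lambda>n. real (card (avoiding_heaps k n (\<tau> ` I))) powr (1 / real n)) \<longlonglongrightarrow> L"
proof -
  define T where "T = \<tau> ` I"
  have T: "(\<exists>m. \<rho> \<in> perms m) \<and> sum_indecomposable \<rho>" if "\<rho> \<in> T" for \<rho>
    using that assms(4,5) unfolding T_def by blast
  have heaps: "card (avoiding_heaps k n T) = card (heap_words k n T)" for n
    by (rule bij_betw_same_card[OF bij_betw_heap_perm])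
  have le: "card (heap_words k n T) \<le> card (Av n T)" for n
    by (rule card_mono) (auto simp: heap_words_def)
  have "1 \<in> I" using assms(2) by auto
  then obtain C where C: "\<And>n. n \<ge> 1 \<Longrightarrow> card (Av n T) \<le> C ^ n"
    using stanley_wilf[OF assms(4), of 1 T] unfolding T_def by blast
  show ?thesis
    unfolding T_def[symmetric] heaps
  proof (cases "\<exists>\<rho>\<in>T. length \<rho> \<le> 1")
    case True
    \<comment> \<open>As \<open>0 powr x\<close> is 0, both sequences vanish from index 1
      on.\<close>
    then have Av: "card (Av n T) = 0" if "n \<ge> 1" for n using Av_eq_empty[OF _ _ that] by auto
    then have "card (heap_words k n T) = 0" if "n \<ge> 1" for n using le[of n] that by simp
    with Av show "\<exists>L::real. (\<lambda>n. real (card (Av n T)) powr (1 / real n)) \<longlonglongrightarrow> L \<and>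
      (\<lambda>n. real (card (heap_words k n T)) powr (1 / real n)) \<longlonglongrightarrow> L"
      by (intro exI[of _ 0] conjI tendsto_eventually eventually_sequentiallyI[of 1]) auto
  next
    case False
    have "[1] \<in> heap_words k 1 T"
    proof -
      \<comment> \<open>Every pattern now has at least two letters, which need two different
        positions.\<close>
      have "\<not> contains_pattern [1] \<rho>" if \<rho>: "\<rho> \<in> T" for \<rho>
      proof
        assume "contains_pattern [1] \<rho>"
        then obtain i where "strict_mono_on {..<length \<rho>} i" "i ` {..<length \<rho>} \<subseteq> {..<1::nat}"
          by (auto simp: contains_pattern_def)
        moreover have "0 < length \<rho>" "1 < length \<rho>" using False \<rho> by auto
        ultimately show False
          by (metis One_nat_def image_subset_iff lessThan_iff less_Suc0 less_irrefl strict_mono_onD zero_less_one)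
      qed
      then show ?thesis
        by (auto simp: heap_words_def Av_def avoids_all_def perms_iff tree_children_def)
    qed
    then have "card (heap_words k 1 T) \<ge> 1"
      using card_gt_0_iff[of "heap_words k 1 T"] by (auto simp: heap_words_def)
    \<comment> \<open>Here \<open>k \<ge> 2\<close> gives
      \<open>p + q \<le> 2 * p \<le> k * p\<close>, so every appended vertex is a child of an old
      one.\<close>
    moreover have "p + q \<le> k * p + 1" if "q \<le> p" for p q
      using mult_le_mono1[OF assms(1), of p] that by linarith
    ultimately show "\<exists>L::real. (\<lambda>n. real (card (Av n T)) powr (1 / real n)) \<longlonglongrightarrow> L \<and>
      (\<lambda>n. real (card (heap_words k n T)) powr (1 / real n)) \<longlonglongrightarrow> L"
      using assms(1) T
      by (intro common_growth_rate[of _ _ C] le C card_heap_words_add) auto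
  qed
qed

end
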